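(* Let $n\ge 1$ be an integer and let $C_1, C_2, \dots$ be independent random variables, each uniformly distributed on $\{1,\dots,n\}$ (so each of the $n$ coupons is collected with probability $\frac1n$ at each draw). Let $N$ be the number of draws needed to complete the collection, $N=\min\{t\ge 1 : \{C_1,\dots,C_t\}=\{1,\dots,n\}\}$. Then $$E(N) = n\sum_{m=1}^{n}\frac{1}{m}.$$
   Context: Coupon collector's problem: there are $n$ coupon types; $C_t$ denotes the type of the coupon obtained at the $t$-th purchase, and $N$ is the number of coupons purchased until at least one coupon of each type has been obtained. $E$ denotes expectation. *)

theory Defs
  imports "HOL-Probability.Probability"
begin

text \<open>
  The collection may never be completed (an event of probability 0), so the number of draws is
  an extended natural number; the infimum of the empty set is \<open>\<infinity>\<close>.
  Draws are numbered from 1; the value \<open>c 0\<close> is irrelevant.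
\<close>
definition collection_time :: "nat \<Rightarrow> (nat \<Rightarrow> nat) \<Rightarrow> enat" where
  "collection_time n c = Inf {enat t | t. t \<ge> 1 \<and> c ` {1..t} = {1..n}}"

end

theory Submission
  imports Defs
begin

text \<open>
  Let \<open>p t k\<close> be the probability that exactly \<open>k\<close> types have been seen after \<open>t\<close> draws.
  By independence of the next draw,
  \<open>p (t+1) (k+1) = (k+1)/n * p t (k+1) + (n-k)/n * p t k\<close>.
  Summing over \<open>t\<close> shows that the expected time spent with exactly \<open>k < n\<close> types is
  \<open>n/(n-k)\<close>, and \<open>E(N)\<close> is the sum of these times over \<open>k < n\<close>.
\<close>

section \<open>Deterministic facts about one sequence of draws\<close>

text \<open>A countable infimum indexed by all times, with \<infinity> at the times that do not
  qualify, is a form from which measurability of the collection time follows directly.\<close>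

lemma collection_time_eq_INF:
  "collection_time n c = (INF t. if t \<ge> 1 \<and> c ` {1..t} = {1..n} then enat t else \<infinity>)"
  unfolding collection_time_def
proof (rule antisym)
  show "Inf {enat t |t. 1 \<le> t \<and> c ` {1..t} = {1..n}}
      \<le> (INF t. if t \<ge> 1 \<and> c ` {1..t} = {1..n} then enat t else \<infinity>)"
    by (intro INF_greatest) (auto intro!: Inf_lower)
  show "(INF t. if t \<ge> 1 \<and> c ` {1..t} = {1..n} then enat t else \<infinity>)
      \<le> Inf {enat t |t. 1 \<le> t \<and> c ` {1..t} = {1..n}}"
  proof (rule Inf_greatest)
    fix x assume "x \<in> {enat t |t. 1 \<le> t \<and> c ` {1..t} = {1..n}}"
    then obtain t where "x = enat t" "1 \<le> t" "c ` {1..t} = {1..n}"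
      by blast
    then show "(INF t. if t \<ge> 1 \<and> c ` {1..t} = {1..n} then enat t else \<infinity>) \<le> x"
      by (intro INF_lower2[of t]) auto
  qed
qed

text \<open>The set of types seen grows with time, so a collection completed by time
  \<open>t\<close> is still complete at \<open>t\<close>. Inside \<open>{1..n}\<close>, being
  incomplete is the same as having fewer than \<open>n\<close> elements.\<close>

lemma less_collection_time_iff:
  assumes n: "n \<ge> 1" and c: "\<And>s. s \<ge> 1 \<Longrightarrow> c s \<in> {1..n}"
  shows "enat t < collection_time n c \<longleftrightarrow> card (c ` {1..t}) < n"
proof -
  have sub: "c ` {1..s} \<subseteq> {1..n}" for s
    using c by auto
  have card_iff: "card (c ` {1..t}) < n \<longleftrightarrow> c ` {1..t} \<noteq> {1..n}"
    using card_subset_eq[OF _ sub[of t]] card_mono[OF _ sub[of t]] by fastforce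
  have mono: "c ` {1..t} = {1..n}" if "s \<le> t" "c ` {1..s} = {1..n}" for s
  proof -
    have "c ` {1..s} \<subseteq> c ` {1..t}" using that(1) by (intro image_mono) auto
    then show ?thesis using that sub[of t] by blast
  qed
  have "enat t < collection_time n c"
    if *: "c ` {1..t} \<noteq> {1..n}"
  proof (rule ccontr)
    assume "\<not> ?thesis"
    \<comment> \<open>The strict bound lets \<open>Inf_less_iff\<close> produce an actual completion
      time \<open>s\<close> \<le> \<open>t\<close>.\<close>
    then have "collection_time n c < enat (Suc t)"
      by (metis enat_ord_simps(2) lessI not_less order_le_less_trans)
    then obtain s where "enat s < enat (Suc t)" "c ` {1..s} = {1..n}"
      unfolding collection_time_def Inf_less_iff by auto
    then show False using mono[of s] * by auto
  qed
  moreover have "\<not> enat t < collection_time n c" if "c ` {1..t} = {1..n}"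
  proof -
    \<comment> \<open>At time 0 nothing has been seen, whereas \<open>{1..n}\<close> is
      nonempty.\<close>
    have "t \<ge> 1" using that n by (cases t) auto
    then have "collection_time n c \<le> enat t"
      unfolding collection_time_def using that by (intro Inf_lower) auto
    then show ?thesis by auto
  qed
  ultimately show ?thesis using card_iff by blast
qed

text \<open>Adding an element of \<open>A\<close> keeps the size, and each of the
  \<open>card S - card A\<close> others raises it by one. Divided by \<open>n\<close>, the two
  coefficients become the transition probabilities of the recurrence.\<close>

lemma sum_card_insert_eq_Suc:
  fixes S A :: "'b set"
  assumes S: "finite S" "A \<subseteq> S" and k: "k < card S"
  shows "(\<Sum>j\<in>S. of_bool (card (insert j A) = Suc k) :: real)
       = real (Suc k) * of_bool (card A = Suc k) + (real (card S) - real k) * of_bool (card A = k)"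
proof -
  have fin: "finite A" using S finite_subset by blast
  have "(\<Sum>j\<in>S. of_bool (card (insert j A) = Suc k) :: real)
      = (\<Sum>j\<in>S - A. of_bool (card (insert j A) = Suc k)) + (\<Sum>j\<in>A. of_bool (card (insert j A) = Suc k))"
    using S by (intro sum.subset_diff) auto
  also have "(\<Sum>j\<in>A. of_bool (card (insert j A) = Suc k) :: real) = (\<Sum>j\<in>A. of_bool (card A = Suc k))"
    by (intro sum.cong) (auto simp: insert_absorb)
  also have "(\<Sum>j\<in>S - A. of_bool (card (insert j A) = Suc k) :: real) = (\<Sum>j\<in>S - A. of_bool (card A = k))"
    using fin by (intro sum.cong) auto
  also have "\<dots> = (real (card S) - real (card A)) * of_bool (card A = k)"
    using S fin card_mono[of S A] by (simp add: card_Diff_subset of_nat_diff)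
  finally show ?thesis by auto
qed

lemma (in prob_space) prob_eq_expectation_of_bool:
  assumes [measurable]: "Measurable.pred M P"
  shows "prob {\<omega> \<in> space M. P \<omega>} = expectation (\<lambda>\<omega>. of_bool (P \<omega>))"
proof -
  have "expectation (\<lambda>\<omega>. of_bool (P \<omega>) :: real) = expectation (indicator {\<omega> \<in> space M. P \<omega>})"
    by (intro Bochner_Integration.integral_cong) (auto simp: indicator_def)
  then show ?thesis by simp
qed

section \<open>Measurability, independence and distribution of the draws\<close>

locale coupon_draws = prob_space M for M :: "'a measure" +
  fixes C :: "nat \<Rightarrow> 'a \<Rightarrow> nat" and n :: nat
  assumes n_pos: "n \<ge> 1"
    and indep: "indep_vars (\<lambda>_. count_space UNIV) C {1..}"
    and distr_draw: "\<And>t. t \<ge> 1 \<Longrightarrow> distr M (count_space UNIV) (C t) = measure_pmf (pmf_of_set {1..n})"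
begin

definition seen :: "nat \<Rightarrow> 'a \<Rightarrow> nat set" where
  "seen t \<omega> = (\<lambda>s. C s \<omega>) ` {1..t}"

definition p :: "nat \<Rightarrow> nat \<Rightarrow> real" where
  "p t k = prob {\<omega> \<in> space M. card (seen t \<omega>) = k}"

lemma seen_Suc: "seen (Suc t) \<omega> = insert (C (Suc t) \<omega>) (seen t \<omega>)"
  by (simp add: seen_def atLeastAtMostSuc_conv)

lemma measurable_draw [measurable]: "t \<ge> 1 \<Longrightarrow> C t \<in> M \<rightarrow>\<^sub>M count_space UNIV"
  using indep unfolding indep_vars_def by auto

text \<open>A finite product of counting spaces over a countable type is again a counting space, so
  every function on it is measurable.\<close>

lemma measurable_image_PiM:
  "(\<lambda>f. f ` {1..t}) \<in> (\<Pi>\<^sub>M s\<in>{1..t}. count_space (UNIV :: nat set)) \<rightarrow>\<^sub>M count_space UNIV"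
  for t :: nat
  by (subst count_space_PiM_finite) auto

lemma image_restrict_seen: "restrict (\<lambda>s. C s \<omega>) {1..t} ` {1..t} = seen t \<omega>"
  unfolding seen_def by (intro image_cong) auto

lemma measurable_seen [measurable]: "seen t \<in> M \<rightarrow>\<^sub>M count_space UNIV"
proof -
  have "(\<lambda>\<omega>. restrict (\<lambda>s. C s \<omega>) {1..t}) \<in> M \<rightarrow>\<^sub>M (\<Pi>\<^sub>M s\<in>{1..t}. count_space UNIV)"
    by (intro measurable_restrict measurable_draw) auto
  from measurable_compose[OF this measurable_image_PiM]
  show ?thesis by (simp only: image_restrict_seen)
qed

text \<open>The two variables are functions of the draws in the disjoint index blocks
  \<open>{1..t}\<close> and \<open>{Suc t}\<close>.\<close>

lemma indep_var_seen_draw: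
  fixes g :: "nat set \<Rightarrow> nat"
  shows "indep_var (count_space UNIV) (\<lambda>\<omega>. g (seen t \<omega>)) (count_space UNIV) (C (Suc t))"
proof -
  have "indep_var (\<Pi>\<^sub>M s\<in>{1..t}. count_space UNIV) (\<lambda>\<omega>. restrict (\<lambda>s. C s \<omega>) {1..t})
      (\<Pi>\<^sub>M s\<in>{Suc t}. count_space UNIV) (\<lambda>\<omega>. restrict (\<lambda>s. C s \<omega>) {Suc t})"
    by (rule indep_var_restrict[OF indep]) auto
  from indep_var_compose[OF this measurable_compose[OF measurable_image_PiM, of g "count_space UNIV"]
      measurable_component_singleton[of "Suc t"]]
  show ?thesis by (simp add: comp_def seen_def)
qed

lemma prob_draw:
  assumes "j \<in> {1..n}"
  shows "prob {\<omega> \<in> space M. C (Suc t) \<omega> = j} = 1 / n"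
proof -
  have "prob {\<omega> \<in> space M. C (Suc t) \<omega> = j} = measure (distr M (count_space UNIV) (C (Suc t))) {j}"
    by (subst measure_distr) (auto intro!: arg_cong[where f = prob])
  also have "\<dots> = 1 / n"
    using assms n_pos by (simp add: distr_draw measure_pmf_single)
  finally show ?thesis .
qed

text \<open>There are only countably many draws, so their exceptional null sets combine into one;
  off it the deterministic facts apply.\<close>

lemma AE_draws: "AE \<omega> in M. \<forall>t\<ge>1. C t \<omega> \<in> {1..n}"
proof -
  have "AE \<omega> in M. C t \<omega> \<in> {1..n}" if "t \<ge> 1" for t
  proof -
    have "AE x in distr M (count_space UNIV) (C t). x \<in> {1..n}"
      unfolding distr_draw[OF that] using n_pos by (subst AE_measure_pmf_iff) simp
    then show ?thesis using that by (subst (asm) AE_distr_iff) auto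
  qed
  then show ?thesis by (auto simp: AE_all_countable)
qed

section \<open>Recurrence for the number of types seen, and its sum over time\<close>

lemma p_0_0: "p 0 0 = 1"
  by (simp add: p_def seen_def prob_space)

lemma p_0_Suc: "p 0 (Suc k) = 0"
  by (simp add: p_def seen_def)

lemma p_Suc_0: "p (Suc t) 0 = 0"
  by (simp add: p_def seen_def)

lemma p_nonneg: "p t k \<ge> 0"
  by (simp add: p_def)

lemma p_eq_expectation: "p t k = expectation (\<lambda>\<omega>. of_bool (card (seen t \<omega>) = k))"
  unfolding p_def by (rule prob_eq_expectation_of_bool) measurable

text \<open>Split by the value \<open>j\<close> of the next draw. Independence turns each piece into
  a product with factor \<open>1 / n\<close>; the sum over \<open>j\<close> then returns inside the
  expectation, where \<open>sum_card_insert_eq_Suc\<close> evaluates it pointwise.\<close>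

lemma p_Suc_Suc:
  assumes k: "k < n"
  shows "p (Suc t) (Suc k) = Suc k / n * p t (Suc k) + (n - k) / n * p t k"
proof -
  let ?A = "\<lambda>j. {\<omega> \<in> space M. card (insert j (seen t \<omega>)) = Suc k}"
  have int_of_bool: "integrable M (\<lambda>\<omega>. of_bool (P \<omega>) :: real)"
    if [measurable]: "Measurable.pred M P" for P
    by (rule integrable_const_bound[where B = 1]) auto
  have [measurable]: "C (Suc t) \<in> M \<rightarrow>\<^sub>M count_space UNIV"
    by (rule measurable_draw) simp
  have exp_insert: "prob (?A j) = expectation (\<lambda>\<omega>. of_bool (card (insert j (seen t \<omega>)) = Suc k))" for j
    by (rule prob_eq_expectation_of_bool) measurable
  have "p (Suc t) (Suc k) = expectation (\<lambda>\<omega>. \<Sum>j=1..n. indicator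
          {\<omega> \<in> space M. card (insert j (seen t \<omega>)) = Suc k \<and> C (Suc t) \<omega> = j} \<omega>)"
    unfolding p_eq_expectation
  proof (rule integral_cong_AE)
    show "AE \<omega> in M. of_bool (card (seen (Suc t) \<omega>) = Suc k) = (\<Sum>j=1..n. indicator
          {\<omega> \<in> space M. card (insert j (seen t \<omega>)) = Suc k \<and> C (Suc t) \<omega> = j} \<omega> :: real)"
      using AE_draws AE_space
    proof eventually_elim
      case (elim \<omega>)
      have "(\<Sum>j=1..n. indicator
            {\<omega> \<in> space M. card (insert j (seen t \<omega>)) = Suc k \<and> C (Suc t) \<omega> = j} \<omega> :: real)
          = (\<Sum>j=1..n. if C (Suc t) \<omega> = j then of_bool (card (seen (Suc t) \<omega>) = Suc k) else 0)"
        using elim by (intro sum.cong) (auto simp: seen_Suc indicator_def)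
      also have "\<dots> = of_bool (card (seen (Suc t) \<omega>) = Suc k)"
        using elim(1)[rule_format, of "Suc t"] by (subst sum.delta') auto
      finally show ?case by simp
    qed
  qed measurable
  also have "\<dots> = (\<Sum>j=1..n. prob {\<omega> \<in> space M. card (insert j (seen t \<omega>)) = Suc k \<and> C (Suc t) \<omega> = j})"
    by (subst Bochner_Integration.integral_sum) (auto simp: emeasure_eq_measure)
  also have "\<dots> = (\<Sum>j=1..n. prob (?A j) * (1 / n))"
  proof (rule sum.cong)
    fix j assume "j \<in> {1..n}"
    have "prob ((\<lambda>\<omega>. (card (insert j (seen t \<omega>)), C (Suc t) \<omega>)) -` ({Suc k} \<times> {j}) \<inter> space M)
        = prob ((\<lambda>\<omega>. card (insert j (seen t \<omega>))) -` {Suc k} \<inter> space M) * prob (C (Suc t) -` {j} \<inter> space M)"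
      by (rule indep_varD[OF indep_var_seen_draw[of "\<lambda>S. card (insert j S)"]]) auto
    moreover have "(\<lambda>\<omega>. (card (insert j (seen t \<omega>)), C (Suc t) \<omega>)) -` ({Suc k} \<times> {j}) \<inter> space M
        = {\<omega> \<in> space M. card (insert j (seen t \<omega>)) = Suc k \<and> C (Suc t) \<omega> = j}"
      "(\<lambda>\<omega>. card (insert j (seen t \<omega>))) -` {Suc k} \<inter> space M = ?A j"
      "C (Suc t) -` {j} \<inter> space M = {\<omega> \<in> space M. C (Suc t) \<omega> = j}"
      by auto
    ultimately show "prob {\<omega> \<in> space M. card (insert j (seen t \<omega>)) = Suc k \<and> C (Suc t) \<omega> = j}
        = prob (?A j) * (1 / n)"
      using prob_draw[OF \<open>j \<in> {1..n}\<close>] by simp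
  qed simp
  also have "\<dots> = expectation (\<lambda>\<omega>. \<Sum>j=1..n. of_bool (card (insert j (seen t \<omega>)) = Suc k)) / n"
    unfolding exp_insert
    by (subst Bochner_Integration.integral_sum) (auto intro!: int_of_bool simp: sum_divide_distrib)
  also have "expectation (\<lambda>\<omega>. \<Sum>j=1..n. of_bool (card (insert j (seen t \<omega>)) = Suc k))
      = expectation (\<lambda>\<omega>. real (Suc k) * of_bool (card (seen t \<omega>) = Suc k)
          + (real n - real k) * of_bool (card (seen t \<omega>) = k))"
  proof (rule integral_cong_AE)
    show "AE \<omega> in M. (\<Sum>j=1..n. of_bool (card (insert j (seen t \<omega>)) = Suc k))
      = real (Suc k) * of_bool (card (seen t \<omega>) = Suc k)
          + (real n - real k) * of_bool (card (seen t \<omega>) = k)"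
      using AE_draws
    proof eventually_elim
      case (elim \<omega>)
      then have "seen t \<omega> \<subseteq> {1..n}" by (auto simp: seen_def)
      then show ?case using sum_card_insert_eq_Suc[of "{1..n}" "seen t \<omega>" k] k by simp
    qed
  qed measurable
  also have "\<dots> = real (Suc k) * p t (Suc k) + (real n - real k) * p t k"
    unfolding p_eq_expectation
    by (subst Bochner_Integration.integral_add) (auto intro!: integrable_mult_right int_of_bool)
  finally show ?thesis
    using k by (simp add: add_divide_distrib distrib_right of_nat_diff)
qed

text \<open>Summed over time, the recurrence becomes a linear equation for the sum \<open>s\<close>
  at level \<open>Suc k\<close>, in which the induction hypothesis makes the contribution of level
  \<open>k\<close> equal to 1. Solving it requires convergence, which is proved first.\<close>

lemma p_sums:
  assumes "k < n"
  shows "(\<lambda>t. p t k) sums (n / (n - k))"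
  using assms
proof (induction k)
  case 0
  \<comment> \<open>After any draw at least one type has been seen, so the whole sum is the initial
    term 1.\<close>
  have "(\<lambda>t. p (Suc t) 0) sums 0"
    by (simp add: p_Suc_0)
  then show ?case
    using n_pos by (subst (asm) sums_Suc_iff) (simp add: p_0_0)
next
  case (Suc k)
  let ?a = "real (Suc k) / n" and ?b = "real (n - k) / n"
  have IH: "(\<lambda>t. p t k) sums (n / (n - k))"
    using Suc by simp
  have rec: "p (Suc t) (Suc k) = ?a * p t (Suc k) + ?b * p t k" for t
    using p_Suc_Suc[of k t] Suc.prems by simp
  have a: "?a < 1" "?a \<ge> 0" and b: "?b * (n / (n - k)) = 1"
    using Suc.prems by auto
  \<comment> \<open>A partial sum \<open>S\<close> is at most the next one, which the recurrence
    bounds by \<open>?a * S + 1\<close>; since \<open>?a < 1\<close>, this bounds \<open>S\<close>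
    itself.\<close>
  have "(\<Sum>t<T. p t (Suc k)) \<le> 1 / (1 - ?a)" for T
  proof -
    have "(\<Sum>t<T. p t (Suc k)) \<le> (\<Sum>t<Suc T. p t (Suc k))"
      by (simp add: p_nonneg)
    also have "\<dots> = ?a * (\<Sum>t<T. p t (Suc k)) + ?b * (\<Sum>t<T. p t k)"
      by (simp only: sum.lessThan_Suc_shift p_0_Suc rec sum.distrib sum_distrib_left add_0)
    also have "(\<Sum>t<T. p t k) \<le> n / (n - k)"
      using IH sum_le_suminf[of "\<lambda>t. p t k" "{..<T}"] p_nonneg by (auto simp: sums_iff)
    then have "?a * (\<Sum>t<T. p t (Suc k)) + ?b * (\<Sum>t<T. p t k) \<le> ?a * (\<Sum>t<T. p t (Suc k)) + 1"
      using b mult_left_mono[of "\<Sum>t<T. p t k" "n / (n - k)" ?b] by simp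
    finally have "(\<Sum>t<T. p t (Suc k)) * (1 - ?a) \<le> 1"
      by (simp add: algebra_simps)
    then show ?thesis using a(1) by (simp only: pos_le_divide_eq diff_gt_0_iff_gt)
  qed
  then have sm: "summable (\<lambda>t. p t (Suc k))"
    by (intro summableI_nonneg_bounded[where x = "1 / (1 - ?a)"] p_nonneg)
  define s where "s = (\<Sum>t. p t (Suc k))"
  have s: "(\<lambda>t. p t (Suc k)) sums s"
    using sm by (simp add: s_def summable_sums)
  have "(\<lambda>t. p (Suc t) (Suc k)) sums (?a * s + 1)"
    using sums_add[OF sums_mult[OF s, of ?a] sums_mult[OF IH, of ?b]] b by (simp only: rec)
  \<comment> \<open>The shift loses only \<open>p 0 (Suc k) = 0\<close>, so the sum is
    unchanged.\<close>
  moreover have "(\<lambda>t. p (Suc t) (Suc k)) sums s"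
    using s by (subst sums_Suc_iff) (simp add: p_0_Suc)
  ultimately have "s = ?a * s + 1"
    by (rule sums_unique2[symmetric])
  then have "s = n / (n - Suc k)"
    using Suc.prems by (simp add: field_simps of_nat_diff)
  then show ?case using s by simp
qed

section \<open>Tail probabilities and expectation of the collection time\<close>

lemma measurable_collection_time:
  "(\<lambda>\<omega>. collection_time n (\<lambda>t. C t \<omega>)) \<in> M \<rightarrow>\<^sub>M count_space UNIV"
  unfolding collection_time_eq_INF seen_def[symmetric] by measurable

text \<open>Almost surely, the collection is incomplete after \<open>t\<close> draws exactly when
  the number of types seen is some \<open>k < n\<close>; these events are disjoint.\<close>

lemma emeasure_less_collection_time:
  "emeasure M {\<omega> \<in> space M. enat t < collection_time n (\<lambda>t. C t \<omega>)} = ennreal (\<Sum>k<n. p t k)"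
proof -
  note measurable_collection_time [measurable]
  have "emeasure M {\<omega> \<in> space M. enat t < collection_time n (\<lambda>t. C t \<omega>)}
      = emeasure M (\<Union>k<n. {\<omega> \<in> space M. card (seen t \<omega>) = k})"
  proof (rule emeasure_eq_AE)
    show "AE \<omega> in M. \<omega> \<in> {\<omega> \<in> space M. enat t < collection_time n (\<lambda>t. C t \<omega>)} \<longleftrightarrow>
        \<omega> \<in> (\<Union>k<n. {\<omega> \<in> space M. card (seen t \<omega>) = k})"
      using AE_draws
    proof eventually_elim
      case (elim \<omega>)
      then show ?case
        using less_collection_time_iff[OF n_pos, of "\<lambda>t. C t \<omega>" t] by (auto simp: seen_def)
    qed
  qed measurable
  also have "\<dots> = ennreal (\<Sum>k<n. p t k)"
    unfolding emeasure_eq_measure p_def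
    by (subst finite_measure_finite_Union) (auto simp: disjoint_family_on_def)
  finally show ?thesis .
qed

text \<open>By the tail formula, E(N) is the sum over \<open>t\<close> of P(N > t). The finite sum
  over \<open>k\<close> can be exchanged with the convergent series over \<open>t\<close>, which
  \<open>p_sums\<close> evaluates.\<close>

lemma nn_integral_collection_time:
  "(\<integral>\<^sup>+ \<omega>. ennreal_of_enat (collection_time n (\<lambda>t. C t \<omega>)) \<partial>M)
     = ennreal (real n * (\<Sum>m = 1..n. 1 / real m))"
proof -
  have sums: "(\<lambda>t. \<Sum>k<n. p t k) sums (\<Sum>k<n. n / (n - k))"
    by (intro sums_sum p_sums) auto
  have "(\<integral>\<^sup>+ \<omega>. ennreal_of_enat (collection_time n (\<lambda>t. C t \<omega>)) \<partial>M) = (\<Sum>t. ennreal (\<Sum>k<n. p t k))"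
    by (simp add: nn_integral_enat_function[OF measurable_collection_time] emeasure_less_collection_time)
  also have "\<dots> = ennreal (\<Sum>k<n. n / (n - k))"
    using sums by (subst suminf_ennreal2) (auto simp: sums_iff p_nonneg sum_nonneg)
  \<comment> \<open>Reindex by the number \<open>m = n - k\<close> of types still missing.\<close>
  also have "(\<Sum>k<n. real n / (n - k)) = (\<Sum>m=1..n. real n / m)"
    by (rule sum.reindex_bij_witness[of _ "\<lambda>m. n - m" "\<lambda>k. n - k"]) auto
  finally show ?thesis by (simp add: sum_distrib_left)
qed

end

theorem theorem1:
  fixes M :: "'a measure" and C :: "nat \<Rightarrow> 'a \<Rightarrow> nat" and n :: nat
  assumes "n \<ge> 1"
    and "prob_space M"
    and "prob_space.indep_vars M (\<lambda>_. count_space UNIV) C {1..}"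
    and "\<And>t. t \<ge> 1 \<Longrightarrow> distr M (count_space UNIV) (C t) = measure_pmf (pmf_of_set {1..n})"
  shows "(\<integral>\<^sup>+ \<omega>. ennreal_of_enat (collection_time n (\<lambda>t. C t \<omega>)) \<partial>M)
           = ennreal (real n * (\<Sum>m = 1..n. 1 / real m))"
proof -
  interpret prob_space M by fact
  interpret coupon_draws M C n
    by unfold_locales (use assms in auto)
  show ?thesis by (rule nn_integral_collection_time)
qed

end
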